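(* Let $n\ge 2$. For every domain $D\subsetneq\mathbb{R}^n$ and all $x,y\in D$, $$\alpha_D(x,y)\le u_D(x,y)\le 2\,\alpha_D(x,y)+2\log 3.$$ The (multiplicative) constant $1$ in the left-hand inequality and the additive constant $2\log 3$ in the right-hand inequality are best possible, i.e. $1$ is the largest constant $c$ such that $c\,\alpha_D(x,y)\le u_D(x,y)$ for all domains $D\subsetneq\mathbb{R}^n$ and $x,y\in D$, and $2\log 3$ is the smallest constant $C$ such that $u_D(x,y)\le 2\alpha_D(x,y)+C$ for all domains $D\subsetneq\mathbb{R}^n$ and $x,y\in D$.
   Context: A domain is a nonempty open connected set. For a domain $D\subsetneq\mathbb{R}^n$ and $x\in D$, $d(x)$ denotes the Euclidean distance from $x$ to the boundary of $D$ in $\mathbb{R}^n$. The Gromov hyperbolic metric $u_D$ is $$u_D(x,y)=2\log\frac{|x-y|+\max\{d(x),d(y)\}}{\sqrt{d(x)\,d(y)}},\qquad x,y\in D.$$ Let $\overline{\mathbb{R}}^n=\mathbb{R}^n\cup\{\infty\}$. For a proper open subset $D$ of $\overline{\mathbb{R}}^n$, with boundary $\partial D$ taken in $\overline{\mathbb{R}}^n$, the Apollonian metric (in general a pseudo-metric) is $$\alpha_D(x,y)=\sup_{p,q\in\partial D}\log|p,x,y,q|,\qquad |p,x,y,q|=\frac{|p-y|\,|x-q|}{|p-x|\,|y-q|},\qquad x,y\in D,$$ where a quotient of two distances to $\infty$ is interpreted as $1$ (e.g. $\frac{|\infty-y|}{|\infty-x|}=1$). *)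

theory Defs
  imports "HOL-Analysis.Analysis"
begin

definition proper_domain :: "'a::euclidean_space set \<Rightarrow> bool" where
  "proper_domain D \<longleftrightarrow> D \<noteq> {} \<and> open D \<and> connected D \<and> D \<noteq> UNIV"

definition gromov_metric :: "'a::euclidean_space set \<Rightarrow> 'a \<Rightarrow> 'a \<Rightarrow> real" where
  "gromov_metric D x y =
     (let d = (\<lambda>z. infdist z (frontier D))
      in 2 * ln ((dist x y + max (d x) (d y)) / sqrt (d x * d y)))"

text \<open>The one-point compactification is the type \<open>'a option\<close> with the topology
  \<^term>\<open>Alexandroff_compactification euclidean\<close>; the point at infinity is \<^term>\<open>None\<close>.\<close>

definition ext_boundary :: "'a::euclidean_space option set \<Rightarrow> 'a option set" where
  "ext_boundary D = (Alexandroff_compactification euclidean) frontier_of D"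

text \<open>Each of the four points of a cross ratio occurs in exactly one distance of the numerator and
  in exactly one of the denominator. Hence counting every distance to infinity as 1 amounts to
  the convention that a quotient of two distances to infinity is 1.\<close>

fun ext_dist :: "'a::euclidean_space option \<Rightarrow> 'a option \<Rightarrow> real" where
  "ext_dist (Some a) (Some b) = dist a b"
| "ext_dist _ _ = 1"

definition cross_ratio ::
  "'a::euclidean_space option \<Rightarrow> 'a option \<Rightarrow> 'a option \<Rightarrow> 'a option \<Rightarrow> real" where
  "cross_ratio p x y q = (ext_dist p y * ext_dist x q) / (ext_dist p x * ext_dist y q)"

definition apollonian_metric ::
  "'a::euclidean_space option set \<Rightarrow> 'a option \<Rightarrow> 'a option \<Rightarrow> real" where
  "apollonian_metric D x y =
     (SUP (p, q) \<in> ext_boundary D \<times> ext_boundary D. ln (cross_ratio p x y q))"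

text \<open>For a proper domain \<open>D\<close> of Euclidean space the real-valued supremum is taken over a nonempty
  set that is bounded above.\<close>

lemma open_vimage_Some:
  assumes "openin (Alexandroff_compactification euclidean) U"
  shows "open (Some -` U)"
proof -
  have "Some -` insert None (Some ` (- C)) = - C" for C :: "'a set"
    by auto
  then show ?thesis
    using assms unfolding openin_Alexandroff_compactification
    by (auto simp: inj_vimage_image_eq Compl_eq_Diff_UNIV[symmetric] open_Compl)
qed

lemma ext_boundary_Some_disjoint:
  assumes "open D"
  shows "ext_boundary (Some ` D) \<inter> Some ` D = {}"
proof -
  have "openin (Alexandroff_compactification euclidean) (Some ` D)"
    using assms by (auto simp: openin_Alexandroff_compactification)
  then show ?thesis
    by (auto simp: ext_boundary_def frontier_of_def interior_of_openin)
qed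

lemma ext_boundary_nonempty:
  assumes "proper_domain D"
  shows "ext_boundary (Some ` D) \<noteq> {}"
proof -
  obtain p where p: "p \<in> frontier D"
    using assms frontier_eq_empty[of D] by (auto simp: proper_domain_def)
  have "p \<in> closure D" "p \<notin> D"
    using p assms by (auto simp: proper_domain_def frontier_def interior_open)
  have "\<exists>y. y \<in> Some ` D \<and> y \<in> U"
    if "Some p \<in> U" "openin (Alexandroff_compactification euclidean) U" for U
  proof -
    have "D \<inter> Some -` U \<noteq> {}"
      using open_vimage_Some[OF that(2)] that(1) \<open>p \<in> closure D\<close>
      by (metis IntI closure_iff_nhds_not_empty empty_iff order_refl vimageI2)
    then show ?thesis by blast
  qed
  then have "Some p \<in> (Alexandroff_compactification euclidean) closure_of (Some ` D)"
    by (auto simp: closure_of_def)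
  moreover have "Some p \<notin> (Alexandroff_compactification euclidean) interior_of (Some ` D)"
    using \<open>p \<notin> D\<close> interior_of_subset by fastforce
  ultimately show ?thesis
    by (auto simp: ext_boundary_def frontier_of_def)
qed

lemma ext_dist_ratio_bounded:
  assumes "open D" "x \<in> D" "y \<in> D"
  obtains B where "\<And>p. p \<in> ext_boundary (Some ` D) \<Longrightarrow>
    0 < ext_dist p (Some y) / ext_dist p (Some x) \<and> ext_dist p (Some y) / ext_dist p (Some x) \<le> B"
proof -
  obtain r where r: "r > 0" "ball x r \<subseteq> D"
    using assms open_contains_ball by blast
  have "0 < ext_dist p (Some y) / ext_dist p (Some x) \<and>
      ext_dist p (Some y) / ext_dist p (Some x) \<le> 1 + dist x y / r"
    if "p \<in> ext_boundary (Some ` D)" for p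
  proof (cases p)
    case None
    then show ?thesis using r by simp
  next
    case (Some a)
    then have a: "a \<notin> D"
      using that ext_boundary_Some_disjoint[OF assms(1)] by auto
    then have "a \<noteq> x" "a \<noteq> y" using assms by auto
    have ra: "r \<le> dist a x"
      using a r by (metis dist_commute linorder_not_le mem_ball subsetD)
    have "dist a y / dist a x \<le> (dist a x + dist x y) / dist a x"
      by (intro divide_right_mono dist_triangle) auto
    also have "\<dots> = 1 + dist x y / dist a x"
      using \<open>a \<noteq> x\<close> by (simp add: add_divide_distrib)
    also have "\<dots> \<le> 1 + dist x y / r"
      using ra r by (intro add_left_mono divide_left_mono mult_pos_pos) auto
    finally show ?thesis using Some \<open>a \<noteq> x\<close> \<open>a \<noteq> y\<close> by simp
  qed
  then show ?thesis using that by blast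
qed

lemma ext_dist_commute: "ext_dist p q = ext_dist q p"
  by (cases p; cases q) (auto simp: dist_commute)

lemma bdd_above_apollonian:
  assumes "open D" "x \<in> D" "y \<in> D"
  shows "bdd_above ((\<lambda>(p, q). ln (cross_ratio p (Some x) (Some y) q)) `
    (ext_boundary (Some ` D) \<times> ext_boundary (Some ` D)))"
proof -
  obtain B where B: "\<And>p. p \<in> ext_boundary (Some ` D) \<Longrightarrow>
    0 < ext_dist p (Some y) / ext_dist p (Some x) \<and> ext_dist p (Some y) / ext_dist p (Some x) \<le> B"
    using ext_dist_ratio_bounded[OF assms] by blast
  obtain C where C: "\<And>p. p \<in> ext_boundary (Some ` D) \<Longrightarrow>
    0 < ext_dist p (Some x) / ext_dist p (Some y) \<and> ext_dist p (Some x) / ext_dist p (Some y) \<le> C"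
    using ext_dist_ratio_bounded[OF assms(1,3,2)] by blast
  have "ln (cross_ratio p (Some x) (Some y) q) \<le> ln B + ln C"
    if "p \<in> ext_boundary (Some ` D)" "q \<in> ext_boundary (Some ` D)" for p q
  proof -
    have "cross_ratio p (Some x) (Some y) q =
        (ext_dist p (Some y) / ext_dist p (Some x)) * (ext_dist q (Some x) / ext_dist q (Some y))"
      by (simp add: cross_ratio_def ext_dist_commute)
    then have "ln (cross_ratio p (Some x) (Some y) q) =
        ln (ext_dist p (Some y) / ext_dist p (Some x)) + ln (ext_dist q (Some x) / ext_dist q (Some y))"
      using B[OF that(1)] C[OF that(2)] by (simp only: ln_mult_pos)
    then show ?thesis
      using B[OF that(1)] C[OF that(2)] by (smt (verit) ln_mono)
  qed
  then show ?thesis by (intro bdd_aboveI2[where M = "ln B + ln C"]) auto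
qed

end

theory Submission
  imports Defs
begin

text \<open>
  Write \<open>r\<close>, \<open>s\<close> for the distances of \<open>x\<close>, \<open>y\<close> to the boundary and \<open>t\<close> for the distance between
  them. With \<open>M = max r s\<close>, the exponential of the Gromov hyperbolic metric is
  \<open>(t + M)\<^sup>2 / (r s)\<close>, so both inequalities compare this quotient with cross ratios.

  A boundary point \<open>p\<close> has \<open>|p - y| / |p - x| \<le> 1 + t / |p - x| \<le> (r + t) / r\<close>, and likewise with
  \<open>x\<close> and \<open>y\<close> exchanged. Each cross ratio is a product of two such quotients, hence at most
  \<open>(r + t) (s + t) / (r s)\<close>. This is the left-hand inequality.

  For the right-hand inequality let \<open>r \<le> s\<close>, by symmetry, and let \<open>p\<close> be a boundary point nearest
  to \<open>x\<close>, so that \<open>|p - y| / |p - x| \<ge> s / r\<close>. There is always a boundary point that is at least as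
  far from \<open>x\<close> as from \<open>y\<close>: infinity, or the point where the ray from \<open>x\<close> through \<open>y\<close> leaves a bounded
  domain. Paired with it, \<open>p\<close> gives a cross ratio of at least \<open>s / r\<close>, which suffices if
  \<open>t \<le> 2 s\<close>, because then \<open>t + s \<le> 3 s\<close>. If \<open>t > 2 s\<close>, pair \<open>p\<close> instead with a boundary point
  nearest to \<open>y\<close>; by the triangle inequality the cross ratio is at least
  \<open>(t - r) (t - s) / (r s)\<close>, and \<open>t + s \<le> 3 (t - s)\<close>.

  Both constants are attained. In a ball, for \<open>x\<close> and \<open>y\<close> opposite with respect to the centre, the
  line through them meets the boundary in points for which every estimate above is an equality, and
  both metrics agree. In the space punctured at the origin, the points \<open>e\<close> and \<open>-e\<close> are
  equidistant from each of the two boundary points, so the Apollonian pseudo-metric vanishes while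
  the Gromov hyperbolic metric equals \<open>2 log 3\<close>.
\<close>

section \<open>Boundary points\<close>

lemma infdist_frontier_pos:
  assumes "proper_domain D" "x \<in> D"
  shows "0 < infdist x (frontier D)"
proof -
  have "frontier D \<noteq> {}"
    using assms frontier_eq_empty[of D] by (auto simp: proper_domain_def)
  moreover have "x \<notin> frontier D"
    using assms by (auto simp: proper_domain_def frontier_def interior_open)
  ultimately show ?thesis
    by (metis closure_closed frontier_closed in_closure_iff_infdist_zero infdist_nonneg
        less_eq_real_def)
qed

text \<open>The segment from a point of \<open>D\<close> to a point outside \<open>D\<close> crosses the frontier.\<close>

lemma infdist_frontier_le_dist:
  fixes D :: "'a::euclidean_space set"
  assumes "x \<in> D" "p \<notin> D"
  shows "infdist x (frontier D) \<le> dist x p"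
proof -
  have "closed_segment x p \<inter> frontier D \<noteq> {}"
    using assms by (intro connected_Int_frontier) auto
  then obtain z where z: "z \<in> closed_segment x p" "z \<in> frontier D"
    by blast
  have "infdist x (frontier D) \<le> dist x z"
    using z by (intro infdist_le)
  also have "\<dots> \<le> dist x p"
    using z(1) dist_in_closed_segment by (metis dist_commute)
  finally show ?thesis .
qed

lemma nearest_frontier_point:
  assumes "proper_domain D"
  obtains p where "p \<in> frontier D" "dist x p = infdist x (frontier D)"
proof -
  have "frontier D \<noteq> {}"
    using assms by (auto simp: proper_domain_def frontier_eq_empty)
  then show ?thesis
    using infdist_attains_inf[OF frontier_closed] that by metis
qed

lemma Some_in_ext_boundary:
  assumes "open D" "p \<in> frontier D"
  shows "Some p \<in> ext_boundary (Some ` D)"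
proof -
  have p: "p \<in> closure D" "p \<notin> D"
    using assms by (auto simp: frontier_def interior_open)
  have "\<exists>y. y \<in> Some ` D \<and> y \<in> U"
    if "Some p \<in> U" "openin (Alexandroff_compactification euclidean) U" for U
  proof -
    have "D \<inter> Some -` U \<noteq> {}"
      using open_vimage_Some[OF that(2)] that(1) p(1)
      by (metis IntI closure_iff_nhds_not_empty empty_iff order_refl vimageI2)
    then show ?thesis by blast
  qed
  then have "Some p \<in> (Alexandroff_compactification euclidean) closure_of (Some ` D)"
    by (auto simp: closure_of_def)
  moreover have "Some p \<notin> (Alexandroff_compactification euclidean) interior_of (Some ` D)"
    using p(2) interior_of_subset by fastforce
  ultimately show ?thesis
    by (auto simp: ext_boundary_def frontier_of_def)
qed

lemma infinity_in_ext_boundary: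
  assumes "\<not> bounded D"
  shows "None \<in> ext_boundary (Some ` D)"
proof -
  have "\<exists>y. y \<in> Some ` D \<and> y \<in> U"
    if "None \<in> U" "openin (Alexandroff_compactification euclidean) U" for U
  proof -
    have "\<exists>C. compact C \<and> U = insert None (Some ` (- C))"
      using that unfolding openin_Alexandroff_compactification
      by (auto simp: Compl_eq_Diff_UNIV)
    then obtain C where C: "compact C" "U = insert None (Some ` (- C))"
      by blast
    have "\<not> D \<subseteq> C"
      using assms C(1) bounded_subset compact_imp_bounded by blast
    then show ?thesis using C(2) by blast
  qed
  then have "None \<in> (Alexandroff_compactification euclidean) closure_of (Some ` D)"
    by (auto simp: closure_of_def)
  moreover have "None \<notin> (Alexandroff_compactification euclidean) interior_of (Some ` D)"
    using interior_of_subset by fastforce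
  ultimately show ?thesis
    by (auto simp: ext_boundary_def frontier_of_def)
qed

text \<open>In an unbounded domain infinity serves; in a bounded one the ray from \<open>x\<close> through \<open>y\<close> must
  leave the domain beyond \<open>y\<close>.\<close>

lemma ext_boundary_point_farther:
  assumes "proper_domain D" "x \<in> D" "y \<in> D"
  obtains q where "q \<in> ext_boundary (Some ` D)"
    "ext_dist (Some y) q \<le> ext_dist (Some x) q"
proof (cases "bounded D")
  case False
  then show ?thesis
    using that[of None] infinity_in_ext_boundary by auto
next
  case True
  show ?thesis
  proof (cases "x = y")
    case True
    then show ?thesis
      using that ext_boundary_nonempty[OF assms(1)] by auto
  next
    case False
    have op: "open D" using assms by (simp add: proper_domain_def)
    obtain d where d: "0 < d" "y + d *\<^sub>R (y - x) \<in> frontier D"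
      using ray_to_frontier[OF True, of y "y - x"] False assms(3) op by (auto simp: interior_open)
    have "dist x (y + d *\<^sub>R (y - x)) = norm ((1 + d) *\<^sub>R (x - y))"
      by (simp add: dist_norm algebra_simps)
    then have "dist x (y + d *\<^sub>R (y - x)) = (1 + d) * norm (x - y)"
      using d(1) by simp
    moreover have "dist y (y + d *\<^sub>R (y - x)) = d * norm (x - y)"
      using d(1) by (simp add: dist_norm norm_minus_commute)
    ultimately have "dist y (y + d *\<^sub>R (y - x)) \<le> dist x (y + d *\<^sub>R (y - x))"
      by (simp add: algebra_simps)
    then show ?thesis
      using that[of "Some (y + d *\<^sub>R (y - x))"] Some_in_ext_boundary[OF op d(2)] by simp
  qed
qed

section \<open>The two metrics\<close>

lemma gromov_metric_eq_ln:
  assumes "proper_domain D" "x \<in> D" "y \<in> D"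
  shows "gromov_metric D x y =
    ln ((dist x y + max (infdist x (frontier D)) (infdist y (frontier D)))\<^sup>2 /
        (infdist x (frontier D) * infdist y (frontier D)))"
proof -
  define r s where "r = infdist x (frontier D)" and "s = infdist y (frontier D)"
  have pos: "0 < r" "0 < s"
    using infdist_frontier_pos assms by (auto simp: r_def s_def)
  have "gromov_metric D x y = 2 * ln ((dist x y + max r s) / sqrt (r * s))"
    by (simp add: gromov_metric_def r_def s_def)
  also have "\<dots> = ln (((dist x y + max r s) / sqrt (r * s))\<^sup>2)"
  proof -
    have "0 < (dist x y + max r s) / sqrt (r * s)"
      using pos by (intro divide_pos_pos add_nonneg_pos) auto
    then show ?thesis by (simp add: ln_realpow)
  qed
  also have "\<dots> = ln ((dist x y + max r s)\<^sup>2 / (r * s))"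
    using pos by (simp add: power_divide)
  finally show ?thesis by (simp add: r_def s_def)
qed

lemma gromov_metric_commute: "gromov_metric D x y = gromov_metric D y x"
  by (simp add: gromov_metric_def dist_commute max.commute mult.commute)

lemma apollonian_metric_commute: "apollonian_metric D x y = apollonian_metric D y x"
proof -
  have "cross_ratio p x y q = cross_ratio q y x p" for p q
    by (simp add: cross_ratio_def ext_dist_commute mult.commute)
  then have swap: "(\<lambda>(p, q). ln (cross_ratio p x y q)) =
      (\<lambda>(p, q). ln (cross_ratio p y x q)) \<circ> prod.swap"
    by (auto simp: fun_eq_iff)
  show ?thesis
    unfolding apollonian_metric_def swap image_comp[symmetric] product_swap ..
qed

lemma ln_cross_ratio_le_apollonian:
  assumes "open D" "x \<in> D" "y \<in> D"
    and "p \<in> ext_boundary (Some ` D)" "q \<in> ext_boundary (Some ` D)"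
  shows "ln (cross_ratio p (Some x) (Some y) q) \<le> apollonian_metric (Some ` D) (Some x) (Some y)"
  using cSUP_upper[OF _ bdd_above_apollonian[OF assms(1-3)], of "(p, q)"] assms(4,5)
  by (simp add: apollonian_metric_def)

section \<open>The Apollonian metric is at most the Gromov hyperbolic metric\<close>

text \<open>By the triangle inequality the ratio exceeds \<open>1\<close> by at most \<open>dist x y / dist p x\<close>, which is
  largest for \<open>p\<close> nearest to \<open>x\<close>; at infinity the ratio is \<open>1\<close>.\<close>

lemma ext_boundary_dist_ratio:
  assumes "proper_domain D" "x \<in> D" "y \<in> D" "p \<in> ext_boundary (Some ` D)"
  shows "0 < ext_dist p (Some y) / ext_dist p (Some x)"
    and "ext_dist p (Some y) / ext_dist p (Some x) \<le>
      (dist x y + infdist x (frontier D)) / infdist x (frontier D)"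
proof -
  define r where "r = infdist x (frontier D)"
  have r: "0 < r"
    using infdist_frontier_pos assms by (auto simp: r_def)
  have "0 < ext_dist p (Some y) / ext_dist p (Some x) \<and>
    ext_dist p (Some y) / ext_dist p (Some x) \<le> (dist x y + r) / r"
  proof (cases p)
    case None
    then show ?thesis using r by simp
  next
    case (Some a)
    have "a \<notin> D"
      using assms Some ext_boundary_Some_disjoint[of D] by (auto simp: proper_domain_def)
    then have ra: "r \<le> dist a x" and "a \<noteq> y"
      using infdist_frontier_le_dist[OF assms(2), of a] assms(3)
      by (auto simp: r_def dist_commute)
    have pos: "0 < dist a x" using r ra by linarith
    have "dist a y / dist a x \<le> (dist a x + dist x y) / dist a x"
      by (intro divide_right_mono dist_triangle) auto
    also have "\<dots> = 1 + dist x y / dist a x"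
      using pos by (simp add: add_divide_distrib)
    also have "\<dots> \<le> 1 + dist x y / r"
      using r ra by (intro add_left_mono divide_left_mono mult_pos_pos) auto
    also have "\<dots> = (dist x y + r) / r"
      using r by (simp add: add_divide_distrib)
    finally show ?thesis using Some pos \<open>a \<noteq> y\<close> by simp
  qed
  then show "0 < ext_dist p (Some y) / ext_dist p (Some x)"
    and "ext_dist p (Some y) / ext_dist p (Some x) \<le>
      (dist x y + infdist x (frontier D)) / infdist x (frontier D)"
    by (auto simp: r_def)
qed

lemma apollonian_le_gromov:
  assumes "proper_domain D" "x \<in> D" "y \<in> D"
  shows "apollonian_metric (Some ` D) (Some x) (Some y) \<le> gromov_metric D x y"
proof -
  define r s t where "r = infdist x (frontier D)" and "s = infdist y (frontier D)"
    and "t = dist x y"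
  have pos: "0 < r" "0 < s" "0 \<le> t"
    using infdist_frontier_pos assms by (auto simp: r_def s_def t_def)
  have "ln (cross_ratio p (Some x) (Some y) q) \<le> gromov_metric D x y"
    if p: "p \<in> ext_boundary (Some ` D)" and q: "q \<in> ext_boundary (Some ` D)" for p q
  proof -
    let ?a = "ext_dist p (Some y) / ext_dist p (Some x)"
    let ?b = "ext_dist q (Some x) / ext_dist q (Some y)"
    have a: "0 < ?a" "?a \<le> (t + r) / r"
      using ext_boundary_dist_ratio[OF assms p] by (simp_all add: r_def t_def)
    have b: "0 < ?b" "?b \<le> (t + s) / s"
      using ext_boundary_dist_ratio[OF assms(1,3,2) q] by (simp_all add: s_def t_def dist_commute)
    have eq: "cross_ratio p (Some x) (Some y) q = ?a * ?b"
      by (simp add: cross_ratio_def ext_dist_commute)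
    have "?a * ?b \<le> ((t + r) / r) * ((t + s) / s)"
      using a b pos by (intro mult_mono) auto
    also have "\<dots> = (t + r) * (t + s) / (r * s)"
      by simp
    also have "\<dots> \<le> (t + max r s)\<^sup>2 / (r * s)"
      unfolding power2_eq_square using pos by (intro divide_right_mono mult_mono) auto
    finally have "cross_ratio p (Some x) (Some y) q \<le> (t + max r s)\<^sup>2 / (r * s)"
      using eq by simp
    moreover have "0 < cross_ratio p (Some x) (Some y) q"
      unfolding eq using a(1) b(1) by (rule mult_pos_pos)
    ultimately have "ln (cross_ratio p (Some x) (Some y) q) \<le> ln ((t + max r s)\<^sup>2 / (r * s))"
      by (intro ln_mono)
    then show ?thesis
      using gromov_metric_eq_ln[OF assms] by (simp add: r_def s_def t_def)
  qed
  then show ?thesis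
    unfolding apollonian_metric_def
    using ext_boundary_nonempty[OF assms(1)] by (intro cSUP_least) auto
qed

section \<open>The Gromov hyperbolic metric is at most twice the Apollonian metric plus a constant\<close>

text \<open>Pair a boundary point \<open>p\<close> nearest to \<open>x\<close>, whose distance to \<open>y\<close> is at least that of \<open>y\<close> to the
  boundary, with a boundary point \<open>q\<close> that is at least as far from \<open>x\<close> as from \<open>y\<close>.\<close>

lemma ln_infdist_ratio_le_apollonian:
  assumes "proper_domain D" "x \<in> D" "y \<in> D"
  shows "ln (infdist y (frontier D) / infdist x (frontier D)) \<le>
    apollonian_metric (Some ` D) (Some x) (Some y)"
proof -
  define r s where "r = infdist x (frontier D)" and "s = infdist y (frontier D)"
  have pos: "0 < r" "0 < s"
    using infdist_frontier_pos assms by (auto simp: r_def s_def)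
  have op: "open D" using assms by (simp add: proper_domain_def)
  obtain p where p: "p \<in> frontier D" "dist x p = r"
    using nearest_frontier_point[OF assms(1)] by (metis r_def)
  obtain q where q: "q \<in> ext_boundary (Some ` D)" "ext_dist (Some y) q \<le> ext_dist (Some x) q"
    using ext_boundary_point_farther[OF assms] by blast
  have sp: "s \<le> dist p y"
    using infdist_le[OF p(1), of y] by (simp add: s_def dist_commute)
  have qpos: "0 < ext_dist (Some y) q"
    using q(1) ext_boundary_Some_disjoint[OF op] assms(3) by (cases q) auto
  have "s / r = s / r * 1"
    by simp
  also have "\<dots> \<le> dist p y / r * (ext_dist (Some x) q / ext_dist (Some y) q)"
    using sp pos q(2) qpos by (intro mult_mono divide_right_mono) auto
  also have "\<dots> = cross_ratio (Some p) (Some x) (Some y) q"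
    using p(2) by (simp add: cross_ratio_def dist_commute)
  finally have "ln (s / r) \<le> ln (cross_ratio (Some p) (Some x) (Some y) q)"
    using pos by (intro ln_mono) auto
  also have "\<dots> \<le> apollonian_metric (Some ` D) (Some x) (Some y)"
    by (intro ln_cross_ratio_le_apollonian op assms q(1) Some_in_ext_boundary p(1))
  finally show ?thesis by (simp add: r_def s_def)
qed

text \<open>The cross ratio of the two nearest boundary points, estimated by the triangle inequality. It
  is informative only if the points are far apart compared with their boundary distances.\<close>

lemma ln_separation_ratio_le_apollonian:
  assumes "proper_domain D" "x \<in> D" "y \<in> D"
    and "infdist x (frontier D) < dist x y" "infdist y (frontier D) < dist x y"
  shows "ln ((dist x y - infdist x (frontier D)) * (dist x y - infdist y (frontier D)) /
      (infdist x (frontier D) * infdist y (frontier D))) \<le>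
    apollonian_metric (Some ` D) (Some x) (Some y)"
proof -
  define r s t where "r = infdist x (frontier D)" and "s = infdist y (frontier D)"
    and "t = dist x y"
  have pos: "0 < r" "0 < s" "r < t" "s < t"
    using infdist_frontier_pos assms by (auto simp: r_def s_def t_def)
  have op: "open D" using assms by (simp add: proper_domain_def)
  obtain p where p: "p \<in> frontier D" "dist x p = r"
    using nearest_frontier_point[OF assms(1)] by (metis r_def)
  obtain q where q: "q \<in> frontier D" "dist y q = s"
    using nearest_frontier_point[OF assms(1)] by (metis s_def)
  have "t - r \<le> dist p y"
    using p(2) dist_triangle[of x y p] by (simp add: t_def)
  moreover have "t - s \<le> dist x q"
    using q(2) dist_triangle[of x y q] by (simp add: t_def dist_commute)
  ultimately have "(t - r) * (t - s) / (r * s) \<le> dist p y * dist x q / (r * s)"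
    using pos by (intro divide_right_mono mult_mono) auto
  also have "\<dots> = cross_ratio (Some p) (Some x) (Some y) (Some q)"
    using p(2) q(2) by (simp add: cross_ratio_def dist_commute)
  finally have "ln ((t - r) * (t - s) / (r * s)) \<le>
      ln (cross_ratio (Some p) (Some x) (Some y) (Some q))"
    using pos by (intro ln_mono) auto
  also have "\<dots> \<le> apollonian_metric (Some ` D) (Some x) (Some y)"
    by (intro ln_cross_ratio_le_apollonian op assms Some_in_ext_boundary p(1) q(1))
  finally show ?thesis by (simp add: r_def s_def t_def)
qed

lemma gromov_le_apollonian_ordered:
  assumes "proper_domain D" "x \<in> D" "y \<in> D"
    and le: "infdist x (frontier D) \<le> infdist y (frontier D)"
  shows "gromov_metric D x y \<le> 2 * apollonian_metric (Some ` D) (Some x) (Some y) + 2 * ln 3"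
proof -
  define r s t where "r = infdist x (frontier D)" and "s = infdist y (frontier D)"
    and "t = dist x y"
  have pos: "0 < r" "0 < s" "0 \<le> t" and rs: "r \<le> s"
    using infdist_frontier_pos assms by (auto simp: r_def s_def t_def)
  obtain E where E: "0 < E" "ln E \<le> apollonian_metric (Some ` D) (Some x) (Some y)"
    "(t + s)\<^sup>2 / (r * s) \<le> (3 * E)\<^sup>2"
  proof (cases "t \<le> 2 * s")
    case True
    have "(t + s)\<^sup>2 \<le> (3 * s)\<^sup>2"
      using True pos by (intro power_mono) auto
    then have "(t + s)\<^sup>2 / (r * s) \<le> (3 * s)\<^sup>2 / (r * s)"
      using pos by (intro divide_right_mono) auto
    also have "\<dots> = 9 * (s / r) * 1"
      using pos by (simp add: power2_eq_square)
    also have "\<dots> \<le> 9 * (s / r) * (s / r)"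
      using pos rs by (intro mult_left_mono) auto
    also have "\<dots> = (3 * (s / r))\<^sup>2"
      by (simp add: power2_eq_square)
    finally show ?thesis
      using that[of "s / r"] ln_infdist_ratio_le_apollonian[OF assms(1-3)] pos
      by (simp add: r_def s_def)
  next
    case False
    have "(t + s)\<^sup>2 * (r * s) \<le> (3 * (t - s))\<^sup>2 * (t - r)\<^sup>2"
    proof (rule mult_mono)
      show "(t + s)\<^sup>2 \<le> (3 * (t - s))\<^sup>2"
        using False pos by (intro power_mono) auto
      show "r * s \<le> (t - r)\<^sup>2"
        unfolding power2_eq_square using False pos rs by (intro mult_mono) auto
    qed (use pos in auto)
    then have "(t + s)\<^sup>2 * (r * s) / (r * s)\<^sup>2 \<le> (3 * (t - s))\<^sup>2 * (t - r)\<^sup>2 / (r * s)\<^sup>2"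
      by (intro divide_right_mono) auto
    also have "\<dots> = (3 * ((t - r) * (t - s) / (r * s)))\<^sup>2"
      by (simp only: power_mult_distrib power_divide times_divide_eq_right mult_ac)
    also have "(t + s)\<^sup>2 * (r * s) / (r * s)\<^sup>2 = (t + s)\<^sup>2 / (r * s)"
      using pos by (simp add: power2_eq_square)
    finally show ?thesis
      using that[of "(t - r) * (t - s) / (r * s)"] False pos rs
        ln_separation_ratio_le_apollonian[OF assms(1-3)]
      by (simp add: r_def s_def t_def)
  qed
  have "gromov_metric D x y = ln ((t + s)\<^sup>2 / (r * s))"
    using gromov_metric_eq_ln[OF assms(1-3)] le by (simp add: r_def s_def t_def max_absorb2)
  also have "\<dots> \<le> ln ((3 * E)\<^sup>2)"
    using E pos by (intro ln_mono divide_pos_pos) auto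
  also have "\<dots> = 2 * ln E + 2 * ln 3"
    using E(1) ln_realpow[of "3 * E" 2] ln_mult_pos[of 3 E] by simp
  finally show ?thesis using E(2) by simp
qed

lemma gromov_le_apollonian:
  assumes "proper_domain D" "x \<in> D" "y \<in> D"
  shows "gromov_metric D x y \<le> 2 * apollonian_metric (Some ` D) (Some x) (Some y) + 2 * ln 3"
  using gromov_le_apollonian_ordered[OF assms] gromov_le_apollonian_ordered[OF assms(1,3,2)]
  by (metis apollonian_metric_commute gromov_metric_commute linorder_le_cases)

section \<open>Extremal domains\<close>

text \<open>In the unit ball the points \<open>\<plusminus> e / 2\<close> have boundary distance \<open>1 / 2\<close> and the boundary points
  \<open>\<plusminus> e\<close> have cross ratio \<open>9\<close>. Since the Gromov hyperbolic metric is \<open>ln 9\<close> too, the general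
  inequality shows that no other pair of boundary points has a larger cross ratio.\<close>

lemma ball_apollonian_eq_gromov:
  fixes e :: "'a::euclidean_space"
  assumes "norm e = 1"
  defines "x \<equiv> - (1/2) *\<^sub>R e" and "y \<equiv> (1/2) *\<^sub>R e"
  shows "proper_domain (ball (0::'a) 1)" and "x \<in> ball 0 1" and "y \<in> ball 0 1"
    and "gromov_metric (ball 0 1) x y = ln 9"
    and "apollonian_metric (Some ` ball 0 1) (Some x) (Some y) = ln 9"
proof -
  show D: "proper_domain (ball (0::'a) 1)"
    using not_bounded_UNIV bounded_ball[of "0::'a" 1] unfolding proper_domain_def
    by (metis centre_in_ball connected_ball empty_iff open_ball zero_less_one)
  show x: "x \<in> ball 0 1" and y: "y \<in> ball 0 1"
    using assms(1) by (auto simp: x_def y_def)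
  have fr: "frontier (ball (0::'a) 1) = sphere 0 1"
    by (simp add: frontier_ball)
  \<comment> \<open>By the triangle inequality no point of the sphere is nearer than \<open>1 - 1/2\<close> to \<open>z\<close>.\<close>
  have half: "infdist z (sphere 0 1) = 1/2"
    if z: "norm z = 1/2" and w: "w \<in> sphere 0 1" "dist z w = 1/2" for z w :: 'a
  proof (rule antisym)
    show "infdist z (sphere 0 1) \<le> 1/2"
      using infdist_le[OF w(1), of z] w(2) by simp
    obtain v where v: "v \<in> sphere 0 1" "infdist z (sphere 0 1) = dist z v"
      using infdist_attains_inf[of "sphere (0::'a) 1" z] w(1) by auto
    show "1/2 \<le> infdist z (sphere 0 1)"
      using norm_triangle_ineq2[of v z] z v by (simp add: dist_norm norm_minus_commute)
  qed
  have on_line: "dist (a *\<^sub>R e) (b *\<^sub>R e) = \<bar>a - b\<bar>" for a b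
    using assms(1) by (simp add: dist_norm flip: scaleR_left_diff_distrib)
  have dists: "dist x (- e) = 1/2" "dist y e = 1/2" "dist x y = 1"
    "dist (- e) y = 3/2" "dist x e = 3/2"
    using on_line[of "-1/2" "-1"] on_line[of "1/2" 1] on_line[of "-1/2" "1/2"]
      on_line[of "-1" "1/2"] on_line[of "-1/2" 1]
    by (simp_all add: x_def y_def)
  have r: "infdist x (frontier (ball 0 1)) = 1/2"
    unfolding fr using assms(1) dists by (intro half[of _ "- e"]) (auto simp: x_def)
  have s: "infdist y (frontier (ball 0 1)) = 1/2"
    unfolding fr using assms(1) dists by (intro half[of _ e]) (auto simp: y_def)
  show u: "gromov_metric (ball 0 1) x y = ln 9"
    unfolding gromov_metric_eq_ln[OF D x y] r s dists by (simp add: power2_eq_square)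
  have "cross_ratio (Some (- e)) (Some x) (Some y) (Some e) = 9"
    by (simp add: cross_ratio_def dist_commute[of "- e" x] dists)
  moreover have "- e \<in> frontier (ball 0 1)" "e \<in> frontier (ball 0 1)"
    unfolding fr using assms(1) by auto
  ultimately have "ln 9 \<le> apollonian_metric (Some ` ball 0 1) (Some x) (Some y)"
    by (metis ln_cross_ratio_le_apollonian Some_in_ext_boundary open_ball x y)
  then show "apollonian_metric (Some ` ball 0 1) (Some x) (Some y) = ln 9"
    using apollonian_le_gromov[OF D x y] u by simp
qed

text \<open>The boundary of the punctured space consists of the origin and infinity. Both are equidistant
  from \<open>e\<close> and \<open>-e\<close>, so every cross ratio is \<open>1\<close>. The dimension is at least two for the punctured
  space to be connected.\<close>

lemma punctured_space_extremal:
  fixes e :: "'a::euclidean_space"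
  assumes "2 \<le> DIM('a)" "norm e = 1"
  shows "proper_domain (- {0::'a})" and "e \<in> - {0}" and "- e \<in> - {0}"
    and "gromov_metric (- {0}) e (- e) = 2 * ln 3"
    and "apollonian_metric (Some ` (- {0})) (Some e) (Some (- e)) = 0"
proof -
  show e: "e \<in> - {0}" "- e \<in> - {0}"
    using assms(2) by auto
  show D: "proper_domain (- {0::'a})"
    using e connected_punctured_universe[OF assms(1), of 0] by (auto simp: proper_domain_def)
  have "frontier (- {0::'a}) = {0}"
    by (simp only: frontier_complement) (simp add: frontier_def)
  moreover have "dist e (- e) = 2"
    using assms(2) norm_scaleR[of 2 e] by (simp add: dist_norm scaleR_2)
  ultimately show "gromov_metric (- {0}) e (- e) = 2 * ln 3"
    using assms(2) by (simp add: gromov_metric_def)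
  have one: "cross_ratio p (Some e) (Some (- e)) q = 1"
    if "p \<in> ext_boundary (Some ` (- {0::'a}))" "q \<in> ext_boundary (Some ` (- {0::'a}))" for p q
  proof -
    have B: "z = None \<or> z = Some 0" if "z \<in> ext_boundary (Some ` (- {0::'a}))" for z
      using that ext_boundary_Some_disjoint[of "- {0::'a}"] by (cases z) auto
    show ?thesis
      using B[OF that(1)] B[OF that(2)] assms(2) by (auto simp: cross_ratio_def)
  qed
  have "(\<lambda>(p, q). ln (cross_ratio p (Some e) (Some (- e)) q)) `
      (ext_boundary (Some ` (- {0::'a})) \<times> ext_boundary (Some ` (- {0::'a}))) = {0}"
    using ext_boundary_nonempty[OF D] one by (force simp: image_iff)
  then show "apollonian_metric (Some ` (- {0})) (Some e) (Some (- e)) = 0"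
    by (simp add: apollonian_metric_def)
qed

section \<open>Comparison of the metrics with best possible constants\<close>

theorem theorem5p6:
  assumes "CARD('n::finite) \<ge> 2"
  shows
    "(\<forall>(D :: (real^'n) set) x y. proper_domain D \<and> x \<in> D \<and> y \<in> D \<longrightarrow>
        apollonian_metric (Some ` D) (Some x) (Some y) \<le> gromov_metric D x y \<and>
        gromov_metric D x y \<le> 2 * apollonian_metric (Some ` D) (Some x) (Some y) + 2 * ln 3) \<and>
     (let S = {c :: real. \<forall>(D :: (real^'n) set) x y. proper_domain D \<and> x \<in> D \<and> y \<in> D \<longrightarrow>
                c * apollonian_metric (Some ` D) (Some x) (Some y) \<le> gromov_metric D x y}
      in 1 \<in> S \<and> (\<forall>c\<in>S. c \<le> 1)) \<and>
     (let T = {C :: real. \<forall>(D :: (real^'n) set) x y. proper_domain D \<and> x \<in> D \<and> y \<in> D \<longrightarrow>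
                gromov_metric D x y \<le> 2 * apollonian_metric (Some ` D) (Some x) (Some y) + C}
      in 2 * ln 3 \<in> T \<and> (\<forall>C\<in>T. 2 * ln 3 \<le> C))"
proof -
  obtain e :: "real^'n" where e: "norm e = 1"
    using vector_choose_size[of 1] by auto
  have dim: "2 \<le> DIM(real^'n)"
    using assms by simp
  have c_le: "c \<le> 1"
    if c: "\<forall>(D :: (real^'n) set) x y. proper_domain D \<and> x \<in> D \<and> y \<in> D \<longrightarrow>
      c * apollonian_metric (Some ` D) (Some x) (Some y) \<le> gromov_metric D x y" for c :: real
  proof -
    have "c * ln 9 \<le> ln 9"
      using c ball_apollonian_eq_gromov[OF e] by metis
    then show ?thesis by simp
  qed
  have C_ge: "2 * ln 3 \<le> C"
    if C: "\<forall>(D :: (real^'n) set) x y. proper_domain D \<and> x \<in> D \<and> y \<in> D \<longrightarrow>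
      gromov_metric D x y \<le> 2 * apollonian_metric (Some ` D) (Some x) (Some y) + C" for C :: real
  proof -
    have "2 * ln 3 \<le> 2 * 0 + C"
      using C punctured_space_extremal[OF dim e] by metis
    then show ?thesis by simp
  qed
  show ?thesis
    unfolding Let_def using c_le C_ge apollonian_le_gromov gromov_le_apollonian by auto
qed

end
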